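(* Let $\alpha$ and $\beta$ be non-negative increasing sequences tending to infinity. For every $\theta=(\theta_n)_{n\in\mathbb{N}_0}\in\Lambda_\infty(\beta)$, the Hankel operator $H_\theta:\Lambda_\infty(\alpha)\to\Lambda_\infty(\beta)$ is continuous and compact.
   Context: $\mathbb{N}=\{1,2,\dots\}$, $\mathbb{N}_0=\mathbb{N}\cup\{0\}$. For a non-negative increasing sequence $\alpha=(\alpha_n)_{n\in\mathbb{N}}$ with $\alpha_n\to\infty$, the power series space of infinite type is the Fréchet space $\Lambda_\infty(\alpha)=\{x=(x_n)_{n\in\mathbb{N}}:\ \|x\|_k:=\sum_{n=1}^\infty|x_n|e^{k\alpha_n}<\infty\ \text{for all }k\in\mathbb{N}\}$ with seminorms $\|\cdot\|_k$, $k\in\mathbb{N}$. The sequence $e_n$ has $1$ in the $n$-th place and $0$ elsewhere. A sequence $\theta=(\theta_n)_{n\in\mathbb{N}_0}$ is identified with the sequence $(\theta_{n-1})_{n\in\mathbb{N}}=(\theta_0,\theta_1,\theta_2,\dots)$ when it is said to belong to a sequence space. The Hankel operator $H_\theta:E\to F$ between such sequence spaces is given by $H_\theta e_n=(\theta_{n-1},\theta_n,\theta_{n+1},\dots)=\sum_{j=1}^\infty\theta_{j+n-2}e_j$ for $n\in\mathbb{N}$ and $H_\theta x=\sum_{n=1}^\infty x_nH_\theta e_n$ for $x=(x_n)\in E$ (its existence as a map means that $H_\theta e_n\in F$ for all $n$ and the series converges in $F$ for every $x\in E$). A linear map $T:E\to F$ between Fréchet spaces is compact if $T(U)$ is precompact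 in $F$ for some neighborhood $U$ of zero in $E$. *)

theory Defs
  imports "HOL-Analysis.Analysis"
begin

text \<open>
  Sequences are indexed from 0 throughout: the entry \<open>x n\<close> of a function on \<open>nat\<close> is the entry
  with index \<open>n + 1\<close> of a sequence indexed by the positive integers, and \<open>\<alpha> n\<close> is the exponent
  with index \<open>n + 1\<close>. A symbol \<open>\<theta>\<close>, which is indexed from 0 anyway and identified with its
  shift to positive indices, is then literally the same function on \<open>nat\<close>.

  The scalar type has the sorts \<open>real_normed_field\<close> and \<open>heine_borel\<close>, which covers both \<open>real\<close>
  and \<open>complex\<close>.
\<close>

definition power_series_space :: "(nat \<Rightarrow> real) \<Rightarrow> (nat \<Rightarrow> 'a::{real_normed_field,heine_borel}) set"
  where "power_series_space \<alpha> =
    {x. \<forall>k::nat. k \<ge> 1 \<longrightarrow> summable (\<lambda>n. norm (x n) * exp (real k * \<alpha> n))}"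

definition ps_seminorm :: "(nat \<Rightarrow> real) \<Rightarrow> nat \<Rightarrow> (nat \<Rightarrow> 'a::{real_normed_field,heine_borel}) \<Rightarrow> real"
  where "ps_seminorm \<alpha> k x = (\<Sum>n. norm (x n) * exp (real k * \<alpha> n))"

text \<open>The locally convex topology of the seminorms with \<open>k \<ge> 1\<close>; the balls form a subbase.\<close>

definition power_series_topology ::
    "(nat \<Rightarrow> real) \<Rightarrow> (nat \<Rightarrow> 'a::{real_normed_field,heine_borel}) topology"
  where "power_series_topology \<alpha> = topology_generated_by
    {{y \<in> power_series_space \<alpha>. ps_seminorm \<alpha> k (\<lambda>n. y n - x n) < \<epsilon>} | x k \<epsilon>.
       x \<in> power_series_space \<alpha> \<and> k \<ge> 1 \<and> \<epsilon> > 0}"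

definition zero_neighborhood ::
    "(nat \<Rightarrow> real) \<Rightarrow> (nat \<Rightarrow> 'a::{real_normed_field,heine_borel}) set \<Rightarrow> bool"
  where "zero_neighborhood \<alpha> U \<longleftrightarrow> U \<subseteq> power_series_space \<alpha> \<and>
    (\<exists>W. openin (power_series_topology \<alpha>) W \<and> (\<lambda>_. 0) \<in> W \<and> W \<subseteq> U)"

text \<open>Precompact means totally bounded for the uniformity of the topological vector space.\<close>

definition ps_precompact ::
    "(nat \<Rightarrow> real) \<Rightarrow> (nat \<Rightarrow> 'a::{real_normed_field,heine_borel}) set \<Rightarrow> bool"
  where "ps_precompact \<alpha> B \<longleftrightarrow> B \<subseteq> power_series_space \<alpha> \<and>
    (\<forall>V. zero_neighborhood \<alpha> V \<longrightarrow>
      (\<exists>F. finite F \<and> F \<subseteq> power_series_space \<alpha> \<and> B \<subseteq> (\<Union>f\<in>F. (\<lambda>v n. f n + v n) ` V)))"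

definition ps_linear_map :: "(nat \<Rightarrow> real) \<Rightarrow> (nat \<Rightarrow> real) \<Rightarrow>
    ((nat \<Rightarrow> 'a::{real_normed_field,heine_borel}) \<Rightarrow> (nat \<Rightarrow> 'a)) \<Rightarrow> bool"
  where "ps_linear_map \<alpha> \<beta> T \<longleftrightarrow>
    T ` power_series_space \<alpha> \<subseteq> power_series_space \<beta> \<and>
    (\<forall>x\<in>power_series_space \<alpha>. \<forall>y\<in>power_series_space \<alpha>.
      T (\<lambda>n. x n + y n) = (\<lambda>n. T x n + T y n)) \<and>
    (\<forall>c. \<forall>x\<in>power_series_space \<alpha>. T (\<lambda>n. c * x n) = (\<lambda>n. c * T x n))"

definition ps_compact_map :: "(nat \<Rightarrow> real) \<Rightarrow> (nat \<Rightarrow> real) \<Rightarrow>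
    ((nat \<Rightarrow> 'a::{real_normed_field,heine_borel}) \<Rightarrow> (nat \<Rightarrow> 'a)) \<Rightarrow> bool"
  where "ps_compact_map \<alpha> \<beta> T \<longleftrightarrow> ps_linear_map \<alpha> \<beta> T \<and>
    (\<exists>U. zero_neighborhood \<alpha> U \<and> ps_precompact \<beta> (T ` U))"

text \<open>The image of the unit vector with its 1 in (0-based) position \<open>n\<close>.\<close>

definition hankel_column :: "(nat \<Rightarrow> 'a) \<Rightarrow> nat \<Rightarrow> (nat \<Rightarrow> 'a)"
  where "hankel_column \<theta> n = (\<lambda>j. \<theta> (j + n))"

definition hankel_partial_sum ::
    "(nat \<Rightarrow> 'a::{real_normed_field,heine_borel}) \<Rightarrow> (nat \<Rightarrow> 'a) \<Rightarrow> nat \<Rightarrow> (nat \<Rightarrow> 'a)"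
  where "hankel_partial_sum \<theta> x N = (\<lambda>j. \<Sum>n<N. x n * hankel_column \<theta> n j)"

definition hankel_exists :: "(nat \<Rightarrow> real) \<Rightarrow> (nat \<Rightarrow> real) \<Rightarrow>
    (nat \<Rightarrow> 'a::{real_normed_field,heine_borel}) \<Rightarrow> bool"
  where "hankel_exists \<alpha> \<beta> \<theta> \<longleftrightarrow>
    (\<forall>n. hankel_column \<theta> n \<in> power_series_space \<beta>) \<and>
    (\<forall>x\<in>power_series_space \<alpha>. \<exists>y.
      limitin (power_series_topology \<beta>) (hankel_partial_sum \<theta> x) y sequentially)"

text \<open>
  The sum of the series in the space with exponents \<open>\<beta>\<close>; the topology is Hausdorff, so the limit
  is unique. The value is meaningful only where the series converges, see \<^const>\<open>hankel_exists\<close>.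
\<close>

definition hankel_operator :: "(nat \<Rightarrow> real) \<Rightarrow>
    (nat \<Rightarrow> 'a::{real_normed_field,heine_borel}) \<Rightarrow> (nat \<Rightarrow> 'a) \<Rightarrow> (nat \<Rightarrow> 'a)"
  where "hankel_operator \<beta> \<theta> x =
    (THE y. limitin (power_series_topology \<beta>) (hankel_partial_sum \<theta> x) y sequentially)"

end

theory Submission imports Defs begin

text \<open>
  Since \<open>\<beta>\<close> is increasing, every column satisfies \<open>\<parallel>H\<^sub>\<theta> e\<^sub>n\<parallel>\<^sub>k \<le> \<parallel>\<theta>\<parallel>\<^sub>k\<close>. Hence the series converges
  absolutely for every \<open>x\<close> in \<open>\<ell>\<^sup>1\<close>, and \<open>\<parallel>H\<^sub>\<theta> x\<parallel>\<^sub>k \<le> (\<Sum>\<^sub>n |x\<^sub>n|) \<parallel>\<theta>\<parallel>\<^sub>k \<le> \<parallel>x\<parallel>\<^sub>1 \<parallel>\<theta>\<parallel>\<^sub>k\<close> for all \<open>k\<close>,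
  where \<open>\<parallel>x\<parallel>\<^sub>1\<close> is the seminorm with \<open>k = 1\<close>. The bound gives continuity; as the seminorm of \<open>x\<close>
  does not depend on \<open>k\<close>, its unit ball is mapped to a bounded set, and because \<open>\<beta> \<rightarrow> \<infinity>\<close>,
  bounded sets of the target are precompact.
\<close>

section \<open>Absolutely convergent series of scalars\<close>

text \<open>
  The sort \<open>{real_normed_field, heine_borel}\<close> yields \<open>complete_space\<close> but not \<open>banach\<close>, so
  the library facts \<open>summable_norm_cancel\<close> and \<open>summable_norm\<close> do not apply.
\<close>

lemma
  fixes f :: "nat \<Rightarrow> 'a::{real_normed_field,heine_borel}"
  assumes f: "summable (\<lambda>n. norm (f n))"
  shows summable_if_summable_norm: "summable f"
    and norm_suminf_le: "norm (suminf f) \<le> (\<Sum>n. norm (f n))"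
proof -
  have "Cauchy (\<lambda>n. sum f {..<n})"
  proof (rule CauchyI)
    fix e :: real assume "e > 0"
    then obtain M where M: "\<And>m n. m \<ge> M \<Longrightarrow> norm (\<Sum>i=m..<n. norm (f i)) < e"
      using f unfolding summable_Cauchy by blast
    \<comment> \<open>Only the case \<open>m \<le> n\<close> is treated; the norm of the difference
      is symmetric in \<open>m\<close> and \<open>n\<close>, which gives the other case
      below.\<close>
    have *: "norm (sum f {..<n} - sum f {..<m}) < e" if "m \<ge> M" "m \<le> n" for m n
    proof -
      have "{..<n} - {..<m} = {m..<n}" by auto
      then have "sum f {..<n} - sum f {..<m} = (\<Sum>i=m..<n. f i)"
        using that sum_diff[of "{..<n}" "{..<m}" f] by simp
      also have "norm \<dots> \<le> (\<Sum>i=m..<n. norm (f i))" by (rule norm_sum)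
      also have "\<dots> < e" using M[OF that(1), of n] by (auto dest: abs_le_D1)
      finally show ?thesis .
    qed
    then show "\<exists>M. \<forall>m\<ge>M. \<forall>n\<ge>M. norm (sum f {..<m} - sum f {..<n}) < e"
      by (metis linear norm_minus_commute)
  qed
  then show s: "summable f"
    by (simp add: Cauchy_convergent_iff summable_iff_convergent)
  show "norm (suminf f) \<le> (\<Sum>n. norm (f n))"
    by (rule LIMSEQ_le[OF tendsto_norm[OF summable_LIMSEQ[OF s]] summable_LIMSEQ[OF f]])
      (auto intro: norm_sum)
qed

section \<open>Power series spaces\<close>

lemma power_series_space_summable:
  "x \<in> power_series_space \<alpha> \<Longrightarrow> k \<ge> 1 \<Longrightarrow> summable (\<lambda>n. norm (x n) * exp (real k * \<alpha> n))"
  by (simp add: power_series_space_def)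

lemma ps_seminorm_nonneg [simp]:
  "x \<in> power_series_space \<alpha> \<Longrightarrow> k \<ge> 1 \<Longrightarrow> 0 \<le> ps_seminorm \<alpha> k x"
  unfolding ps_seminorm_def by (intro suminf_nonneg power_series_space_summable) auto

lemma ps_seminorm_zero [simp]: "ps_seminorm \<alpha> k (\<lambda>_. 0) = 0"
  by (simp add: ps_seminorm_def)

lemma power_series_space_finite_support:
  assumes "\<And>n. n \<ge> N \<Longrightarrow> x n = 0"
  shows "x \<in> power_series_space \<alpha>"
  unfolding power_series_space_def
  using assms leI by (auto intro!: summable_finite[of "{..<N}"]) blast

lemma zero_in_power_series_space [simp]: "(\<lambda>_. 0) \<in> power_series_space \<alpha>"
  by (rule power_series_space_finite_support) simp

lemma
  assumes "x \<in> power_series_space \<alpha>" "y \<in> power_series_space \<alpha>"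
  shows power_series_space_add: "(\<lambda>n. x n + y n) \<in> power_series_space \<alpha>"
    and ps_seminorm_triangle:
      "k \<ge> 1 \<Longrightarrow> ps_seminorm \<alpha> k (\<lambda>n. x n + y n) \<le> ps_seminorm \<alpha> k x + ps_seminorm \<alpha> k y"
proof -
  have le: "norm (x n + y n) * exp (real k * \<alpha> n)
      \<le> norm (x n) * exp (real k * \<alpha> n) + norm (y n) * exp (real k * \<alpha> n)" for n k
    by (metis distrib_right exp_ge_zero mult_right_mono norm_triangle_ineq)
  have s: "summable (\<lambda>n. norm (x n) * exp (real k * \<alpha> n) + norm (y n) * exp (real k * \<alpha> n))"
    if "k \<ge> 1" for k
    using assms that by (intro summable_add power_series_space_summable)
  have s': "summable (\<lambda>n. norm (x n + y n) * exp (real k * \<alpha> n))" if "k \<ge> 1" for k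
    by (rule summable_comparison_test'[OF s[OF that], of 0]) (use le in auto)
  then show "(\<lambda>n. x n + y n) \<in> power_series_space \<alpha>"
    by (simp add: power_series_space_def)
  assume k: "k \<ge> 1"
  show "ps_seminorm \<alpha> k (\<lambda>n. x n + y n) \<le> ps_seminorm \<alpha> k x + ps_seminorm \<alpha> k y"
    unfolding ps_seminorm_def
    using suminf_le[OF le s'[OF k] s[OF k]] assms k
    by (simp add: suminf_add power_series_space_summable)
qed

lemma power_series_space_minus:
  "x \<in> power_series_space \<alpha> \<Longrightarrow> (\<lambda>n. - x n) \<in> power_series_space \<alpha>"
  by (simp add: power_series_space_def)

lemma power_series_space_diff:
  assumes "x \<in> power_series_space \<alpha>" "y \<in> power_series_space \<alpha>"
  shows "(\<lambda>n. x n - y n) \<in> power_series_space \<alpha>"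
  using power_series_space_add[OF assms(1) power_series_space_minus[OF assms(2)]] by simp

lemma ps_seminorm_triangle_diff:
  assumes "x \<in> power_series_space \<alpha>" "y \<in> power_series_space \<alpha>" "z \<in> power_series_space \<alpha>" "k \<ge> 1"
  shows "ps_seminorm \<alpha> k (\<lambda>n. x n - z n)
    \<le> ps_seminorm \<alpha> k (\<lambda>n. x n - y n) + ps_seminorm \<alpha> k (\<lambda>n. y n - z n)"
  using ps_seminorm_triangle[OF power_series_space_diff[OF assms(1,2)]
      power_series_space_diff[OF assms(2,3)] assms(4)] by simp

text \<open>As \<open>\<alpha>\<close> is non-negative, the weights
  \<open>exp (k * \<alpha> n)\<close> grow with \<open>k\<close>. Hence the seminorms form a
  directed family, and finitely many of them are dominated by a single one.\<close>

lemma ps_seminorm_mono: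
  assumes "\<forall>n. 0 \<le> \<alpha> n" "x \<in> power_series_space \<alpha>" "1 \<le> k" "k \<le> l"
  shows "ps_seminorm \<alpha> k x \<le> ps_seminorm \<alpha> l x"
  unfolding ps_seminorm_def using assms
  by (intro suminf_le power_series_space_summable mult_left_mono) (auto intro: mult_right_mono)

text \<open>All weights are at least 1, so the space embeds into l^1. For the source this is the
  only summability that the Hankel series uses; for the target it bounds single coordinates.\<close>

lemma
  assumes "\<forall>n. 0 \<le> \<alpha> n" "x \<in> power_series_space \<alpha>" "k \<ge> 1"
  shows summable_norm_power_series_space: "summable (\<lambda>n. norm (x n))"
    and suminf_norm_le_ps_seminorm: "(\<Sum>n. norm (x n)) \<le> ps_seminorm \<alpha> k x"
    and norm_le_ps_seminorm: "norm (x n) \<le> ps_seminorm \<alpha> k x"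
proof -
  have s: "summable (\<lambda>n. norm (x n) * exp (real k * \<alpha> n))"
    using assms by (simp add: power_series_space_summable)
  have le: "norm (x n) \<le> norm (x n) * exp (real k * \<alpha> n)" for n
    using mult_left_mono[of 1 "exp (real k * \<alpha> n)" "norm (x n)"] assms(1) by simp
  show s': "summable (\<lambda>n. norm (x n))"
    by (rule summable_comparison_test'[OF s, of 0]) (use le in auto)
  show "(\<Sum>n. norm (x n)) \<le> ps_seminorm \<alpha> k x"
    unfolding ps_seminorm_def by (rule suminf_le[OF le s' s])
  then show "norm (x n) \<le> ps_seminorm \<alpha> k x"
    using sum_le_suminf[OF s', of "{n}"] by simp
qed

section \<open>The topology\<close>

text \<open>Names the members of the subbase in \<open>power_series_topology\<close>. The centre is
  not forced to lie in the space, so lemmas about balls state this where they rely on it.\<close>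

definition ps_ball ::
    "(nat \<Rightarrow> real) \<Rightarrow> (nat \<Rightarrow> 'a::{real_normed_field,heine_borel}) \<Rightarrow> nat \<Rightarrow> real \<Rightarrow> (nat \<Rightarrow> 'a) set"
  where "ps_ball \<alpha> x k \<epsilon> =
    {y \<in> power_series_space \<alpha>. ps_seminorm \<alpha> k (\<lambda>n. y n - x n) < \<epsilon>}"

text \<open>Directedness of the seminorms puts a ball into the intersection of two balls with the
  same centre, and the triangle inequality recentres a ball at any of its points. So the balls about
  a point form a neighbourhood base there, and the generated topology is handled like a metric
  one.\<close>

lemma openin_power_series_topology:
  fixes W :: "(nat \<Rightarrow> 'a::{real_normed_field,heine_borel}) set"
  assumes "\<forall>n. 0 \<le> \<alpha> n"
  shows "openin (power_series_topology \<alpha>) W \<longleftrightarrow>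
    W \<subseteq> power_series_space \<alpha> \<and> (\<forall>x\<in>W. \<exists>k\<ge>1. \<exists>\<epsilon>>0. ps_ball \<alpha> x k \<epsilon> \<subseteq> W)"
    (is "_ \<longleftrightarrow> ?P W")
proof
  define S where "S = {ps_ball \<alpha> x k \<epsilon> | x k \<epsilon>.
    (x::nat \<Rightarrow> 'a) \<in> power_series_space \<alpha> \<and> k \<ge> 1 \<and> \<epsilon> > 0}"
  have top: "power_series_topology \<alpha> = topology_generated_by S"
    unfolding power_series_topology_def S_def ps_ball_def by simp
  show "?P W" if "openin (power_series_topology \<alpha>) W"
  proof -
    have "generate_topology_on S W"
      using that unfolding top openin_topology_generated_by_iff .
    then show ?thesis
    proof induction
      case (Int U V)
      have "\<exists>k\<ge>1. \<exists>\<epsilon>>0. ps_ball \<alpha> x k \<epsilon> \<subseteq> U \<inter> V" if x: "x \<in> U" "x \<in> V" for x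
      proof -
        obtain k \<epsilon> where 1: "k \<ge> 1" "\<epsilon> > 0" "ps_ball \<alpha> x k \<epsilon> \<subseteq> U"
          using Int x by metis
        obtain l \<delta> where 2: "l \<ge> 1" "\<delta> > 0" "ps_ball \<alpha> x l \<delta> \<subseteq> V"
          using Int x by metis
        \<comment> \<open>The larger index gives the larger seminorm, so one ball controls both
          conditions.\<close>
        have "ps_ball \<alpha> x (max k l) (min \<epsilon> \<delta>) \<subseteq> ps_ball \<alpha> x k \<epsilon> \<inter> ps_ball \<alpha> x l \<delta>"
        proof
          fix y assume y: "y \<in> ps_ball \<alpha> x (max k l) (min \<epsilon> \<delta>)"
          have "(\<lambda>n. y n - x n) \<in> power_series_space \<alpha>"
            using y x Int by (intro power_series_space_diff) (auto simp: ps_ball_def)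
          then have "ps_seminorm \<alpha> k (\<lambda>n. y n - x n) \<le> ps_seminorm \<alpha> (max k l) (\<lambda>n. y n - x n)"
            "ps_seminorm \<alpha> l (\<lambda>n. y n - x n) \<le> ps_seminorm \<alpha> (max k l) (\<lambda>n. y n - x n)"
            using 1 2 assms by (auto intro!: ps_seminorm_mono)
          with y show "y \<in> ps_ball \<alpha> x k \<epsilon> \<inter> ps_ball \<alpha> x l \<delta>"
            by (simp add: ps_ball_def)
        qed
        with 1 2 show ?thesis
          by (intro exI[of _ "max k l"] exI[of _ "min \<epsilon> \<delta>"] conjI) auto
      qed
      with Int show ?case by blast
    next
      case (UN K)
      then show ?case by (meson UnionE Union_least Union_upper subset_trans)
    next
      case (Basis U)
      then obtain x k \<epsilon> where U: "U = ps_ball \<alpha> x k \<epsilon>" "x \<in> power_series_space \<alpha>" "k \<ge> 1" "\<epsilon> > 0"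
        by (auto simp: S_def)
      have "\<exists>k'\<ge>1. \<exists>\<delta>>0. ps_ball \<alpha> y k' \<delta> \<subseteq> U" if y: "y \<in> U" for y
      proof (intro exI conjI)
        show "k \<ge> 1" by fact
        \<comment> \<open>The radius left over at \<open>y\<close>: a point closer to
          \<open>y\<close> than this stays within \<open>\<epsilon>\<close> of
          \<open>x\<close>.\<close>
        show "\<epsilon> - ps_seminorm \<alpha> k (\<lambda>n. y n - x n) > 0"
          using y U by (simp add: ps_ball_def)
        show "ps_ball \<alpha> y k (\<epsilon> - ps_seminorm \<alpha> k (\<lambda>n. y n - x n)) \<subseteq> U"
        proof
          fix z assume z: "z \<in> ps_ball \<alpha> y k (\<epsilon> - ps_seminorm \<alpha> k (\<lambda>n. y n - x n))"
          then show "z \<in> U"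
            using y U ps_seminorm_triangle_diff[of z \<alpha> y x k] by (auto simp: ps_ball_def)
        qed
      qed
      with U show ?case by (auto simp: ps_ball_def)
    qed simp
  qed
  show "openin (power_series_topology \<alpha>) W" if W: "?P W"
  proof (subst openin_subopen, intro ballI)
    fix x assume x: "x \<in> W"
    then obtain k \<epsilon> where k: "k \<ge> 1" "\<epsilon> > 0" "ps_ball \<alpha> x k \<epsilon> \<subseteq> W"
      using W by blast
    have "ps_ball \<alpha> x k \<epsilon> \<in> S"
      unfolding S_def using k x W by blast
    then have "openin (power_series_topology \<alpha>) (ps_ball \<alpha> x k \<epsilon>)"
      unfolding top by (rule topology_generated_by_Basis)
    moreover have "x \<in> ps_ball \<alpha> x k \<epsilon>"
      using k x W by (auto simp: ps_ball_def)
    ultimately show "\<exists>T. openin (power_series_topology \<alpha>) T \<and> x \<in> T \<and> T \<subseteq> W"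
      using k by blast
  qed
qed

lemma openin_ps_ball:
  assumes "x \<in> power_series_space \<alpha>" "k \<ge> 1" "\<epsilon> > 0"
  shows "openin (power_series_topology \<alpha>) (ps_ball \<alpha> x k \<epsilon>)"
  unfolding power_series_topology_def ps_ball_def
  using assms by (intro topology_generated_by_Basis) blast

lemma centre_in_ps_ball:
  "x \<in> power_series_space \<alpha> \<Longrightarrow> \<epsilon> > 0 \<Longrightarrow> x \<in> ps_ball \<alpha> x k \<epsilon>"
  by (simp add: ps_ball_def)

lemma topspace_power_series_topology [simp]:
  assumes "\<forall>n. 0 \<le> \<alpha> n"
  shows "topspace (power_series_topology \<alpha>) = power_series_space \<alpha>"
proof
  show "topspace (power_series_topology \<alpha>) \<subseteq> power_series_space \<alpha>"
    using openin_power_series_topology[OF assms] openin_topspace by blast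
  have "openin (power_series_topology \<alpha>) (power_series_space \<alpha>)"
    unfolding openin_power_series_topology[OF assms] ps_ball_def
    by (auto intro!: exI[of _ "1::nat"] exI[of _ "1::real"])
  then show "power_series_space \<alpha> \<subseteq> topspace (power_series_topology \<alpha>)"
    by (rule openin_subset)
qed

lemma zero_neighborhood_ps_ball:
  assumes "k \<ge> 1" "\<epsilon> > 0"
  shows "zero_neighborhood \<alpha> (ps_ball \<alpha> (\<lambda>_. 0) k \<epsilon>)"
  unfolding zero_neighborhood_def
  by (intro conjI exI[of _ "ps_ball \<alpha> (\<lambda>_. 0) k \<epsilon>"] openin_ps_ball centre_in_ps_ball assms)
    (auto simp: ps_ball_def)

lemma zero_neighborhoodE:
  assumes "zero_neighborhood \<alpha> V" "\<forall>n. 0 \<le> \<alpha> n"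
  obtains k \<epsilon> where "k \<ge> 1" "\<epsilon> > 0" "ps_ball \<alpha> (\<lambda>_. 0) k \<epsilon> \<subseteq> V"
  using assms(1) unfolding zero_neighborhood_def openin_power_series_topology[OF assms(2)]
  by (meson subset_trans)

section \<open>Convergence and continuity in terms of the seminorms\<close>

text \<open>The balls about \<open>l\<close> are open and form a neighbourhood base at
  \<open>l\<close>, so it suffices to test convergence on them.\<close>

lemma limitin_power_series_topology:
  fixes f :: "nat \<Rightarrow> nat \<Rightarrow> 'a::{real_normed_field,heine_borel}"
  assumes nn: "\<forall>n. 0 \<le> \<alpha> n" and f: "\<And>N. f N \<in> power_series_space \<alpha>"
  shows "limitin (power_series_topology \<alpha>) f l sequentially \<longleftrightarrow>
    l \<in> power_series_space \<alpha> \<and>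
    (\<forall>k\<ge>1. (\<lambda>N. ps_seminorm \<alpha> k (\<lambda>n. f N n - l n)) \<longlonglongrightarrow> 0)" (is "?L \<longleftrightarrow> ?R")
proof
  assume L: ?L
  then have l: "l \<in> power_series_space \<alpha>"
    using limitin_topspace[OF L] nn by simp
  have "(\<lambda>N. ps_seminorm \<alpha> k (\<lambda>n. f N n - l n)) \<longlonglongrightarrow> 0" if k: "k \<ge> 1" for k
  proof (rule tendstoI)
    fix e :: real assume e: "e > 0"
    have "\<forall>\<^sub>F N in sequentially. f N \<in> ps_ball \<alpha> l k e"
      using L openin_ps_ball[OF l k e] centre_in_ps_ball[OF l e] by (auto simp: limitin_def)
    then show "\<forall>\<^sub>F N in sequentially. dist (ps_seminorm \<alpha> k (\<lambda>n. f N n - l n)) 0 < e"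
    proof eventually_elim
      case (elim N)
      then show ?case
        using ps_seminorm_nonneg[OF power_series_space_diff[OF f[of N] l] k]
        by (simp add: ps_ball_def)
    qed
  qed
  with l show ?R by blast
next
  assume R: ?R
  show ?L
    unfolding limitin_def topspace_power_series_topology[OF nn]
  proof (intro conjI allI impI)
    show "l \<in> power_series_space \<alpha>" using R by blast
    fix U assume U: "openin (power_series_topology \<alpha>) U \<and> l \<in> U"
    then obtain k \<epsilon> where k: "k \<ge> 1" "\<epsilon> > 0" "ps_ball \<alpha> l k \<epsilon> \<subseteq> U"
      using openin_power_series_topology[OF nn] by blast
    have "\<forall>\<^sub>F N in sequentially. ps_seminorm \<alpha> k (\<lambda>n. f N n - l n) < \<epsilon>"
      using R k by (intro order_tendstoD) auto
    then show "\<forall>\<^sub>F N in sequentially. f N \<in> U"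
    proof eventually_elim
      case (elim N)
      then show ?case using k f by (auto simp: ps_ball_def)
    qed
  qed
qed

text \<open>The first seminorm dominates every coordinate, so a limit is also the coordinatewise
  limit. This makes the definite description in \<open>hankel_operator\<close> meaningful.\<close>

lemma limitin_power_series_topology_unique:
  fixes f :: "nat \<Rightarrow> nat \<Rightarrow> 'a::{real_normed_field,heine_borel}"
  assumes nn: "\<forall>n. 0 \<le> \<alpha> n" and f: "\<And>N. f N \<in> power_series_space \<alpha>"
    and l: "limitin (power_series_topology \<alpha>) f l sequentially"
      "limitin (power_series_topology \<alpha>) f l' sequentially"
  shows "l = l'"
proof
  fix n
  have "(\<lambda>N. f N n) \<longlonglongrightarrow> l n" if "limitin (power_series_topology \<alpha>) f l sequentially" for l
  proof -
    have l: "l \<in> power_series_space \<alpha>" "(\<lambda>N. ps_seminorm \<alpha> 1 (\<lambda>n. f N n - l n)) \<longlonglongrightarrow> 0"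
      using that limitin_power_series_topology[of \<alpha> f l] nn f by auto
    have "norm (f N n - l n) \<le> ps_seminorm \<alpha> 1 (\<lambda>n. f N n - l n)" for N
      by (rule norm_le_ps_seminorm[OF nn power_series_space_diff[OF f l(1)]]) simp
    then have "(\<lambda>N. f N n - l n) \<longlonglongrightarrow> 0"
      by (intro Lim_null_comparison[OF _ l(2)]) auto
    then show ?thesis by (simp add: LIM_zero_iff)
  qed
  with l show "l n = l' n" by (blast intro: LIMSEQ_unique)
qed

text \<open>A Lipschitz bound for each target seminorm sends a small enough ball about
  \<open>x\<close> into a given ball about \<open>T x\<close>, which is continuity at
  \<open>x\<close>.\<close>

lemma continuous_map_power_series_topology:
  fixes T :: "(nat \<Rightarrow> 'a::{real_normed_field,heine_borel}) \<Rightarrow> nat \<Rightarrow> 'b::{real_normed_field,heine_borel}"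
  assumes nn: "\<forall>n. 0 \<le> \<alpha> n" "\<forall>n. 0 \<le> \<beta> n"
    and T: "\<And>x. x \<in> power_series_space \<alpha> \<Longrightarrow> T x \<in> power_series_space \<beta>"
    and bound: "\<And>k. k \<ge> 1 \<Longrightarrow> \<exists>l\<ge>1. \<exists>C. \<forall>x\<in>power_series_space \<alpha>. \<forall>y\<in>power_series_space \<alpha>.
      ps_seminorm \<beta> k (\<lambda>n. T y n - T x n) \<le> C * ps_seminorm \<alpha> l (\<lambda>n. y n - x n)"
  shows "continuous_map (power_series_topology \<alpha>) (power_series_topology \<beta>) T"
  unfolding continuous_map topspace_power_series_topology[OF nn(1)]
    topspace_power_series_topology[OF nn(2)]
proof (intro conjI allI impI)
  show "T ` power_series_space \<alpha> \<subseteq> power_series_space \<beta>" using T by blast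
  fix W :: "(nat \<Rightarrow> 'b) set" assume W: "openin (power_series_topology \<beta>) W"
  have "\<exists>l\<ge>1. \<exists>\<delta>>0. ps_ball \<alpha> x l \<delta> \<subseteq> {x \<in> power_series_space \<alpha>. T x \<in> W}"
    if x: "x \<in> power_series_space \<alpha>" "T x \<in> W" for x
  proof -
    obtain k \<epsilon> where k: "k \<ge> 1" "\<epsilon> > 0" "ps_ball \<beta> (T x) k \<epsilon> \<subseteq> W"
      using W x openin_power_series_topology[OF nn(2)] by blast
    obtain l C where l: "l \<ge> 1" and
      C: "\<And>y. y \<in> power_series_space \<alpha> \<Longrightarrow>
        ps_seminorm \<beta> k (\<lambda>n. T y n - T x n) \<le> C * ps_seminorm \<alpha> l (\<lambda>n. y n - x n)"
      using bound[OF k(1)] x by blast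
    \<comment> \<open>The divisor is positive whatever the sign of \<open>C\<close>, including
      \<open>C = 0\<close>.\<close>
    have "ps_ball \<alpha> x l (\<epsilon> / (\<bar>C\<bar> + 1)) \<subseteq> {x \<in> power_series_space \<alpha>. T x \<in> W}"
    proof
      fix y assume y: "y \<in> ps_ball \<alpha> x l (\<epsilon> / (\<bar>C\<bar> + 1))"
      then have y': "y \<in> power_series_space \<alpha>" by (simp add: ps_ball_def)
      have "ps_seminorm \<beta> k (\<lambda>n. T y n - T x n) \<le> C * ps_seminorm \<alpha> l (\<lambda>n. y n - x n)"
        by (rule C[OF y'])
      also have "\<dots> \<le> (\<bar>C\<bar> + 1) * ps_seminorm \<alpha> l (\<lambda>n. y n - x n)"
        by (intro mult_right_mono ps_seminorm_nonneg power_series_space_diff y' x l) auto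
      also have "\<dots> < \<epsilon>"
        using y by (simp add: ps_ball_def pos_less_divide_eq mult.commute)
      finally show "y \<in> {x \<in> power_series_space \<alpha>. T x \<in> W}"
        using k T y' by (auto simp: ps_ball_def)
    qed
    moreover have "\<epsilon> / (\<bar>C\<bar> + 1) > 0" using k by simp
    ultimately show ?thesis using l by blast
  qed
  then show "openin (power_series_topology \<alpha>) {x \<in> power_series_space \<alpha>. T x \<in> W}"
    unfolding openin_power_series_topology[OF nn(1)] by blast
qed

section \<open>Bounded sets are precompact\<close>

text \<open>Beyond a large index \<open>N\<close> the seminorm with index \<open>k\<close> is at
  most \<open>exp (- \<beta> N)\<close> times the one with index \<open>k + 1\<close>, hence
  uniformly small on \<open>B\<close>. The first \<open>N\<close> coordinates range over a bounded
  set of scalars and are approximated from a finite net.\<close>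

lemma ps_precompact_if_bounded:
  fixes B :: "(nat \<Rightarrow> 'a::{real_normed_field,heine_borel}) set"
  assumes nn: "\<forall>n. 0 \<le> \<beta> n" and mono: "mono \<beta>" and lim: "filterlim \<beta> at_top sequentially"
    and B: "B \<subseteq> power_series_space \<beta>"
    and C: "\<And>k y. k \<ge> 1 \<Longrightarrow> y \<in> B \<Longrightarrow> ps_seminorm \<beta> k y \<le> C k"
  shows "ps_precompact \<beta> B"
  unfolding ps_precompact_def
proof (intro conjI allI impI B)
  fix V :: "(nat \<Rightarrow> 'a) set" assume V: "zero_neighborhood \<beta> V"
  then obtain k \<epsilon> where k: "k \<ge> 1" "\<epsilon> > 0" "ps_ball \<beta> (\<lambda>_. 0) k \<epsilon> \<subseteq> V"
    using zero_neighborhoodE[OF V nn] by blast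
  \<comment> \<open>Chooses the cut-off \<open>N\<close> so that the tails of all members of
    \<open>B\<close> contribute less than \<open>\<epsilon> / 2\<close>. This is where
    \<open>\<beta>\<close> tending to infinity enters.\<close>
  have "((\<lambda>n. exp (- \<beta> n) * C (Suc k)) \<longlongrightarrow> 0 * C (Suc k)) sequentially"
    by (intro tendsto_intros filterlim_compose[OF exp_at_bot]
        filterlim_compose[OF filterlim_uminus_at_bot_at_top] lim)
  then have "\<forall>\<^sub>F n in sequentially. exp (- \<beta> n) * C (Suc k) < \<epsilon> / 2"
    using k by (intro order_tendstoD) auto
  then obtain N where N: "exp (- \<beta> N) * C (Suc k) < \<epsilon> / 2"
    by (auto simp: eventually_sequentially)
  \<comment> \<open>With this mesh the \<open>N\<close> head coordinates, each of weight at most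
    \<open>exp (k * \<beta> N)\<close>, contribute at most \<open>\<epsilon> / 2\<close> together;
    \<open>N + 1\<close> keeps the denominator positive for \<open>N = 0\<close>.\<close>
  define \<delta> where "\<delta> = \<epsilon> / (2 * (real N + 1) * exp (real k * \<beta> N))"
  have \<delta>: "\<delta> > 0"
    unfolding \<delta>_def using k by (intro divide_pos_pos mult_pos_pos) auto
  have head: "real N * (\<delta> * exp (real k * \<beta> N)) \<le> \<epsilon> / 2"
  proof -
    have "real N * (\<delta> * exp (real k * \<beta> N)) = \<epsilon> / 2 * (real N / (real N + 1))"
      unfolding \<delta>_def by (simp add: divide_simps)
    also have "\<dots> \<le> \<epsilon> / 2 * 1"
      using k by (intro mult_left_mono) auto
    finally show ?thesis by simp
  qed
  \<comment> \<open>One net serves every coordinate of every member of \<open>B\<close>, since all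
    of them are bounded by \<open>C 1\<close>; its finiteness comes from compactness of closed balls
    of scalars.\<close>
  obtain D :: "'a set" where D: "finite D" "cball 0 (C 1) \<subseteq> (\<Union>d\<in>D. ball d \<delta>)"
    using compact_cball[of "0::'a" "C 1", unfolded compact_eq_totally_bounded] \<delta> by metis
  \<comment> \<open>All choices of net points in the first \<open>N\<close> places, continued by 0:
    finitely many sequences, independent of the point to be approximated.\<close>
  define F where "F = (\<lambda>g n. if n < N then g n else 0) ` (PiE {..<N} (\<lambda>_. D))"
  have F_space: "F \<subseteq> power_series_space \<beta>"
    unfolding F_def
    by (rule image_subsetI, rule power_series_space_finite_support[of N]) simp
  have cover: "\<exists>f\<in>F. (\<lambda>n. y n - f n) \<in> V" if y: "y \<in> B" for y
  proof -
    have ys: "y \<in> power_series_space \<beta>" using y B by blast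
    have "\<exists>d\<in>D. norm (y n - d) < \<delta>" for n
    proof -
      have "norm (y n) \<le> C 1"
        using norm_le_ps_seminorm[OF nn ys, of 1 n] C[OF _ y, of 1] by simp
      then have "y n \<in> cball 0 (C 1)" by simp
      with D obtain d where "d \<in> D" "y n \<in> ball d \<delta>" by blast
      then show ?thesis by (auto simp: dist_norm norm_minus_commute)
    qed
    then obtain g where g: "\<And>n. g n \<in> D" "\<And>n. norm (y n - g n) < \<delta>" by metis
    define f where "f = (\<lambda>n. if n < N then g n else 0)"
    have fF: "f \<in> F"
      unfolding F_def f_def by (rule image_eqI[of _ _ "restrict g {..<N}"]) (auto simp: g)
    have diff: "(\<lambda>n. y n - f n) \<in> power_series_space \<beta>"
      using fF F_space by (intro power_series_space_diff ys) auto
    \<comment> \<open>Majorants for the head and the tail. Both are non-negative, so their sum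
      bounds the term at every \<open>n\<close> and each series can be summed separately.\<close>
    let ?h = "\<lambda>n. if n < N then \<delta> * exp (real k * \<beta> N) else 0"
    let ?t = "\<lambda>n. exp (- \<beta> N) * (norm (y n) * exp (real (Suc k) * \<beta> n))"
    have le: "norm (y n - f n) * exp (real k * \<beta> n) \<le> ?h n + ?t n" for n
    proof (cases "n < N")
      case True
      then have "real k * \<beta> n \<le> real k * \<beta> N"
        using mono by (intro mult_left_mono) (auto simp: mono_def)
      then have "norm (y n - g n) * exp (real k * \<beta> n) \<le> \<delta> * exp (real k * \<beta> N)"
        using g(2)[of n] \<delta> by (intro mult_mono) auto
      then show ?thesis using True by (simp add: f_def add_increasing2)
    next
      case False
      then have "\<beta> N \<le> \<beta> n" using mono by (simp add: mono_def)
      \<comment> \<open>One unit of the index is traded for the small factor: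
        \<open>k * \<beta> n \<le> (k + 1) * \<beta> n - \<beta> N\<close>.\<close>
      then have "exp (real k * \<beta> n) \<le> exp (- \<beta> N) * exp (real (Suc k) * \<beta> n)"
        by (simp add: exp_add[symmetric] algebra_simps)
      then have "norm (y n) * exp (real k * \<beta> n) \<le> norm (y n) * (exp (- \<beta> N) * exp (real (Suc k) * \<beta> n))"
        by (intro mult_left_mono) auto
      then show ?thesis using False by (simp add: f_def mult_ac)
    qed
    have hs: "?h sums (\<Sum>n<N. \<delta> * exp (real k * \<beta> N))"
      using sums_If_finite[of "\<lambda>n. n < N" "\<lambda>_. \<delta> * exp (real k * \<beta> N)"]
      by (simp add: lessThan_def)
    have ts: "?t sums (exp (- \<beta> N) * ps_seminorm \<beta> (Suc k) y)"
      unfolding ps_seminorm_def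
      by (intro sums_mult summable_sums power_series_space_summable ys) simp
    have "ps_seminorm \<beta> k (\<lambda>n. y n - f n)
        \<le> (\<Sum>n<N. \<delta> * exp (real k * \<beta> N)) + exp (- \<beta> N) * ps_seminorm \<beta> (Suc k) y"
      unfolding ps_seminorm_def[of \<beta> k]
      by (rule sums_le[OF le summable_sums[OF power_series_space_summable[OF diff k(1)]]
            sums_add[OF hs ts]])
    also have "\<dots> \<le> \<epsilon> / 2 + exp (- \<beta> N) * C (Suc k)"
      using head C[OF _ y, of "Suc k"] by (intro add_mono mult_left_mono) auto
    also have "\<dots> < \<epsilon>" using N by simp
    finally have "(\<lambda>n. y n - f n) \<in> ps_ball \<beta> (\<lambda>_. 0) k \<epsilon>"
      using diff by (simp add: ps_ball_def)
    with k fF show ?thesis by blast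
  qed
  show "\<exists>F. finite F \<and> F \<subseteq> power_series_space \<beta> \<and> B \<subseteq> (\<Union>f\<in>F. (\<lambda>v n. f n + v n) ` V)"
  proof (intro exI conjI)
    show "finite F"
      unfolding F_def using D by (intro finite_imageI finite_PiE) auto
    show "F \<subseteq> power_series_space \<beta>" by (rule F_space)
    show "B \<subseteq> (\<Union>f\<in>F. (\<lambda>v n. f n + v n) ` V)"
    proof
      fix y assume "y \<in> B"
      then obtain f where f: "f \<in> F" "(\<lambda>n. y n - f n) \<in> V" using cover by blast
      show "y \<in> (\<Union>f\<in>F. (\<lambda>v n. f n + v n) ` V)"
        by (rule UN_I[OF f(1)], rule image_eqI[OF _ f(2)]) simp
    qed
  qed
qed

section \<open>The Hankel series\<close>

text \<open>Monotonicity of \<open>\<beta>\<close> allows replacing the weight at \<open>j\<close>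
  by the larger one at \<open>j + n\<close>; what results is a tail of the series for the seminorm
  of \<open>\<theta>\<close>. The bound is uniform in \<open>n\<close>.\<close>

lemma
  fixes \<theta> :: "nat \<Rightarrow> 'a::{real_normed_field,heine_borel}"
  assumes mono: "mono \<beta>" and \<theta>: "\<theta> \<in> power_series_space \<beta>" and k: "k \<ge> 1"
  shows summable_hankel_column:
      "summable (\<lambda>j. norm (hankel_column \<theta> n j) * exp (real k * \<beta> j))"
    and ps_seminorm_hankel_column: "ps_seminorm \<beta> k (hankel_column \<theta> n) \<le> ps_seminorm \<beta> k \<theta>"
proof -
  let ?w = "\<lambda>j. norm (\<theta> j) * exp (real k * \<beta> j)"
  have w: "summable ?w" using \<theta> k by (rule power_series_space_summable)
  then have w': "summable (\<lambda>j. ?w (j + n))" by (subst summable_iff_shift)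
  have le: "norm (hankel_column \<theta> n j) * exp (real k * \<beta> j) \<le> ?w (j + n)" for j
    using mono by (auto simp: hankel_column_def mono_def intro!: mult_left_mono)
  show s: "summable (\<lambda>j. norm (hankel_column \<theta> n j) * exp (real k * \<beta> j))"
    by (rule summable_comparison_test'[OF w', of 0]) (use le in auto)
  have "ps_seminorm \<beta> k (hankel_column \<theta> n) \<le> (\<Sum>j. ?w (j + n))"
    unfolding ps_seminorm_def by (rule suminf_le[OF le s w'])
  also have "\<dots> \<le> (\<Sum>j. ?w j)"
    using suminf_split_initial_segment[OF w, of n] sum_nonneg[of "{..<n}" ?w] by simp
  finally show "ps_seminorm \<beta> k (hankel_column \<theta> n) \<le> ps_seminorm \<beta> k \<theta>"
    by (simp add: ps_seminorm_def)
qed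

text \<open>The coordinatewise candidate for the limit, defined without reference to a topology. It
  is studied for arbitrary l^1 sequences, so that truncations and remainders of \<open>x\<close> are
  covered too.\<close>

definition hankel_sum :: "(nat \<Rightarrow> 'a::{real_normed_field,heine_borel}) \<Rightarrow> (nat \<Rightarrow> 'a) \<Rightarrow> nat \<Rightarrow> 'a"
  where "hankel_sum \<theta> x = (\<lambda>j. \<Sum>n. x n * hankel_column \<theta> n j)"

text \<open>The entries of \<open>\<theta>\<close> are bounded by its first seminorm, and a bounded
  factor preserves absolute summability.\<close>

lemma summable_hankel_sum:
  fixes \<theta> x :: "nat \<Rightarrow> 'a::{real_normed_field,heine_borel}"
  assumes nn: "\<forall>n. 0 \<le> \<beta> n" and \<theta>: "\<theta> \<in> power_series_space \<beta>" and x: "summable (\<lambda>n. norm (x n))"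
  shows "summable (\<lambda>n. norm (x n * hankel_column \<theta> n j))"
proof (rule summable_comparison_test'[OF summable_mult2[OF x, of "ps_seminorm \<beta> 1 \<theta>"], of 0])
  fix n
  show "norm (norm (x n * hankel_column \<theta> n j)) \<le> norm (x n) * ps_seminorm \<beta> 1 \<theta>"
    using norm_le_ps_seminorm[OF nn \<theta>, of 1 "j + n"]
    by (simp add: norm_mult hankel_column_def mult_left_mono)
qed

text \<open>A uniform bound on the partial sums over \<open>j\<close> gives both membership and the
  estimate. For finitely many \<open>j\<close> the two summations commute by additivity of series,
  so no interchange of two infinite sums occurs.\<close>

lemma
  fixes \<theta> x :: "nat \<Rightarrow> 'a::{real_normed_field,heine_borel}"
  assumes nn: "\<forall>n. 0 \<le> \<beta> n" and mono: "mono \<beta>" and \<theta>: "\<theta> \<in> power_series_space \<beta>"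
    and x: "summable (\<lambda>n. norm (x n))"
  shows hankel_sum_in_space: "hankel_sum \<theta> x \<in> power_series_space \<beta>"
    and ps_seminorm_hankel_sum:
      "k \<ge> 1 \<Longrightarrow> ps_seminorm \<beta> k (hankel_sum \<theta> x) \<le> (\<Sum>n. norm (x n)) * ps_seminorm \<beta> k \<theta>"
proof -
  have partial: "(\<Sum>j<J. norm (hankel_sum \<theta> x j) * exp (real k * \<beta> j))
      \<le> (\<Sum>n. norm (x n)) * ps_seminorm \<beta> k \<theta>" if k: "k \<ge> 1" for k J
  proof -
    let ?a = "\<lambda>n j. norm (x n * hankel_column \<theta> n j) * exp (real k * \<beta> j)"
    note s = summable_hankel_sum[OF nn \<theta> x]
    have sa: "summable (\<lambda>n. ?a n j)" for j by (rule summable_mult2[OF s])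
    have "(\<Sum>j<J. norm (hankel_sum \<theta> x j) * exp (real k * \<beta> j)) \<le> (\<Sum>j<J. \<Sum>n. ?a n j)"
    proof (rule sum_mono)
      fix j
      have "norm (hankel_sum \<theta> x j) \<le> (\<Sum>n. norm (x n * hankel_column \<theta> n j))"
        unfolding hankel_sum_def by (rule norm_suminf_le[OF s])
      then show "norm (hankel_sum \<theta> x j) * exp (real k * \<beta> j) \<le> (\<Sum>n. ?a n j)"
        by (simp add: suminf_mult2[OF s, symmetric] mult_right_mono)
    qed
    also have "\<dots> = (\<Sum>n. \<Sum>j<J. ?a n j)"
      by (rule suminf_sum[symmetric]) (rule sa)
    also have "\<dots> \<le> (\<Sum>n. norm (x n) * ps_seminorm \<beta> k \<theta>)"
    proof (rule suminf_le)
      fix n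
      have "(\<Sum>j<J. ?a n j)
          = norm (x n) * (\<Sum>j<J. norm (hankel_column \<theta> n j) * exp (real k * \<beta> j))"
        by (simp add: norm_mult sum_distrib_left mult_ac)
      also have "(\<Sum>j<J. norm (hankel_column \<theta> n j) * exp (real k * \<beta> j))
          \<le> ps_seminorm \<beta> k (hankel_column \<theta> n)"
        unfolding ps_seminorm_def
        by (rule sum_le_suminf[OF summable_hankel_column[OF mono \<theta> k]]) auto
      also note ps_seminorm_hankel_column[OF mono \<theta> k]
      finally show "(\<Sum>j<J. ?a n j) \<le> norm (x n) * ps_seminorm \<beta> k \<theta>"
        by (simp add: mult_left_mono)
    qed (intro summable_sum sa summable_mult2 x)+
    also have "\<dots> = (\<Sum>n. norm (x n)) * ps_seminorm \<beta> k \<theta>"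
      by (rule suminf_mult2[OF x, symmetric])
    finally show ?thesis .
  qed
  have s: "summable (\<lambda>j. norm (hankel_sum \<theta> x j) * exp (real k * \<beta> j))" if "k \<ge> 1" for k
    by (rule bounded_imp_summable[of _ "(\<Sum>n. norm (x n)) * ps_seminorm \<beta> k \<theta>"])
      (use partial[OF that] in \<open>auto simp: lessThan_Suc_atMost[symmetric] simp del: sum.lessThan_Suc\<close>)
  then show "hankel_sum \<theta> x \<in> power_series_space \<beta>"
    by (simp add: power_series_space_def)
  show "ps_seminorm \<beta> k (hankel_sum \<theta> x) \<le> (\<Sum>n. norm (x n)) * ps_seminorm \<beta> k \<theta>" if "k \<ge> 1"
    unfolding ps_seminorm_def[of \<beta> k "hankel_sum \<theta> x"]
    by (rule suminf_le_const[OF s[OF that] partial[OF that]])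
qed

lemma
  fixes \<theta> x y :: "nat \<Rightarrow> 'a::{real_normed_field,heine_borel}"
  assumes nn: "\<forall>n. 0 \<le> \<beta> n" and \<theta>: "\<theta> \<in> power_series_space \<beta>"
    and x: "summable (\<lambda>n. norm (x n))" and y: "summable (\<lambda>n. norm (y n))"
  shows hankel_sum_add: "hankel_sum \<theta> (\<lambda>n. x n + y n) = (\<lambda>j. hankel_sum \<theta> x j + hankel_sum \<theta> y j)"
    and hankel_sum_diff: "hankel_sum \<theta> (\<lambda>n. x n - y n) = (\<lambda>j. hankel_sum \<theta> x j - hankel_sum \<theta> y j)"
proof -
  note s = summable_if_summable_norm[OF summable_hankel_sum[OF nn \<theta> x]]
    summable_if_summable_norm[OF summable_hankel_sum[OF nn \<theta> y]]
  show "hankel_sum \<theta> (\<lambda>n. x n + y n) = (\<lambda>j. hankel_sum \<theta> x j + hankel_sum \<theta> y j)"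
    by (simp add: hankel_sum_def distrib_right suminf_add[OF s])
  show "hankel_sum \<theta> (\<lambda>n. x n - y n) = (\<lambda>j. hankel_sum \<theta> x j - hankel_sum \<theta> y j)"
    by (simp add: hankel_sum_def left_diff_distrib suminf_diff[OF s])
qed

lemma hankel_sum_mult:
  fixes \<theta> x :: "nat \<Rightarrow> 'a::{real_normed_field,heine_borel}"
  assumes "\<forall>n. 0 \<le> \<beta> n" "\<theta> \<in> power_series_space \<beta>" "summable (\<lambda>n. norm (x n))"
  shows "hankel_sum \<theta> (\<lambda>n. c * x n) = (\<lambda>j. c * hankel_sum \<theta> x j)"
  by (simp add: hankel_sum_def mult.assoc
      suminf_mult[OF summable_if_summable_norm[OF summable_hankel_sum[OF assms]]])

text \<open>Expressing partial sums through truncations of \<open>x\<close> makes the estimate for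
  \<open>hankel_sum\<close> apply to them and to their distance from the limit.\<close>

lemma hankel_partial_sum_eq:
  "hankel_partial_sum \<theta> x N = hankel_sum \<theta> (\<lambda>n. if n < N then x n else 0)"
  unfolding hankel_partial_sum_def hankel_sum_def
  by (rule ext, subst suminf_finite[of "{..<N}"]) auto

text \<open>The error after \<open>N\<close> terms is \<open>hankel_sum\<close> applied to the
  negative of the tail of \<open>x\<close>, so each of its seminorms is at most the l^1 norm of that
  tail times the seminorm of \<open>\<theta>\<close>.\<close>

lemma
  fixes \<theta> x :: "nat \<Rightarrow> 'a::{real_normed_field,heine_borel}"
  assumes nn: "\<forall>n. 0 \<le> \<beta> n" and mono: "mono \<beta>" and \<theta>: "\<theta> \<in> power_series_space \<beta>"
    and x: "summable (\<lambda>n. norm (x n))"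
  shows limitin_hankel_sum:
      "limitin (power_series_topology \<beta>) (hankel_partial_sum \<theta> x) (hankel_sum \<theta> x) sequentially"
    and hankel_operator_eq: "hankel_operator \<beta> \<theta> x = hankel_sum \<theta> x"
proof -
  let ?x = "\<lambda>N n. if n < N then x n else 0"
  have sx: "summable (\<lambda>n. norm (?x N n))" for N
    by (rule summable_finite[of "{..<N}"]) auto
  have space: "hankel_partial_sum \<theta> x N \<in> power_series_space \<beta>" for N
    unfolding hankel_partial_sum_eq by (rule hankel_sum_in_space[OF nn mono \<theta> sx])
  have tail: "(\<lambda>N. \<Sum>n. norm (x (n + N))) \<longlonglongrightarrow> 0"
    using x by (rule suminf_exist_split2)
  have bound: "ps_seminorm \<beta> k (\<lambda>n. hankel_partial_sum \<theta> x N n - hankel_sum \<theta> x n)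
      \<le> (\<Sum>n. norm (x (n + N))) * ps_seminorm \<beta> k \<theta>" if k: "k \<ge> 1" for k N
  proof -
    let ?r = "\<lambda>n. ?x N n - x n"
    have sr: "summable (\<lambda>n. norm (?r n))"
      by (rule summable_comparison_test'[OF x, of 0]) auto
    \<comment> \<open>The first \<open>N\<close> entries of \<open>?r\<close> vanish, so splitting
      them off leaves exactly the tail.\<close>
    have "(\<Sum>n. norm (?r n)) = (\<Sum>n. norm (x (n + N)))"
      using suminf_split_initial_segment[OF sr, of N] by simp
    then show ?thesis
      using ps_seminorm_hankel_sum[OF nn mono \<theta> sr k]
      by (simp add: hankel_partial_sum_eq hankel_sum_diff[OF nn \<theta> sx x])
  qed
  show lim: "limitin (power_series_topology \<beta>) (hankel_partial_sum \<theta> x) (hankel_sum \<theta> x) sequentially"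
    unfolding limitin_power_series_topology[OF nn space]
  proof (intro conjI allI impI hankel_sum_in_space[OF nn mono \<theta> x])
    fix k :: nat assume k: "k \<ge> 1"
    have "(\<lambda>N. (\<Sum>n. norm (x (n + N))) * ps_seminorm \<beta> k \<theta>) \<longlonglongrightarrow> 0"
      using tendsto_mult_right[OF tail, of "ps_seminorm \<beta> k \<theta>"] by simp
    then show "(\<lambda>N. ps_seminorm \<beta> k (\<lambda>n. hankel_partial_sum \<theta> x N n - hankel_sum \<theta> x n)) \<longlonglongrightarrow> 0"
      by (rule tendsto_sandwich[OF _ _ tendsto_const, rotated 2])
        (auto intro!: always_eventually bound[OF k] ps_seminorm_nonneg[OF _ k]
          power_series_space_diff space hankel_sum_in_space[OF nn mono \<theta> x])
  qed
  show "hankel_operator \<beta> \<theta> x = hankel_sum \<theta> x"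
    unfolding hankel_operator_def
    using lim limitin_power_series_topology_unique[OF nn space _ lim] by (rule the_equality)
qed

section \<open>Existence, continuity and compactness of the Hankel operator\<close>

theorem theorem3p5:
  fixes \<alpha> \<beta> :: "nat \<Rightarrow> real"
    and \<theta> :: "nat \<Rightarrow> 'a::{real_normed_field,heine_borel}"
  assumes "\<And>n. 0 \<le> \<alpha> n" and "mono \<alpha>" and "filterlim \<alpha> at_top sequentially"
    and "\<And>n. 0 \<le> \<beta> n" and "mono \<beta>" and "filterlim \<beta> at_top sequentially"
    and "\<theta> \<in> power_series_space \<beta>"
  shows "hankel_exists \<alpha> \<beta> \<theta> \<and>
    continuous_map (power_series_topology \<alpha>) (power_series_topology \<beta>) (hankel_operator \<beta> \<theta>) \<and>
    ps_compact_map \<alpha> \<beta> (hankel_operator \<beta> \<theta>)"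
proof -
  let ?T = "hankel_operator \<beta> \<theta>" and ?A = "power_series_space \<alpha> :: (nat \<Rightarrow> 'a) set"
  have \<alpha>: "\<forall>n. 0 \<le> \<alpha> n" and \<beta>: "\<forall>n. 0 \<le> \<beta> n" "mono \<beta>"
    and \<theta>: "\<theta> \<in> power_series_space \<beta>"
    using assms by auto
  have l1: "summable (\<lambda>n. norm (x n))" if "x \<in> ?A" for x
    by (rule summable_norm_power_series_space[OF \<alpha> that order.refl])
  note T = hankel_operator_eq[OF \<beta> \<theta> l1]
  have T_space: "?T x \<in> power_series_space \<beta>" if "x \<in> ?A" for x
    using that by (simp add: T hankel_sum_in_space[OF \<beta> \<theta> l1])
  \<comment> \<open>The source seminorm has index 1 for every \<open>k\<close>. This uniformity lets
    a single zero neighbourhood serve for compactness.\<close>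
  have bound: "ps_seminorm \<beta> k (?T x) \<le> ps_seminorm \<beta> k \<theta> * ps_seminorm \<alpha> 1 x"
    if "x \<in> ?A" "k \<ge> 1" for x k
  proof -
    have "ps_seminorm \<beta> k (?T x) \<le> (\<Sum>n. norm (x n)) * ps_seminorm \<beta> k \<theta>"
      unfolding T[OF that(1)] by (rule ps_seminorm_hankel_sum[OF \<beta> \<theta> l1 that(2)]) (rule that(1))
    also have "\<dots> \<le> ps_seminorm \<alpha> 1 x * ps_seminorm \<beta> k \<theta>"
      using that \<theta> by (intro mult_right_mono suminf_norm_le_ps_seminorm \<alpha>) auto
    finally show ?thesis by (simp add: mult.commute)
  qed
  have ex: "hankel_exists \<alpha> \<beta> \<theta>"
    unfolding hankel_exists_def
    using limitin_hankel_sum[OF \<beta> \<theta> l1] summable_hankel_column[OF \<beta>(2) \<theta>]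
    by (auto simp: power_series_space_def[of \<beta>])
  have linear: "ps_linear_map \<alpha> \<beta> ?T"
    unfolding ps_linear_map_def
  proof (intro conjI ballI allI)
    show "?T ` ?A \<subseteq> power_series_space \<beta>" using T_space by blast
    fix x y :: "nat \<Rightarrow> 'a" assume x: "x \<in> ?A" and y: "y \<in> ?A"
    show "?T (\<lambda>n. x n + y n) = (\<lambda>n. ?T x n + ?T y n)"
      by (simp add: T x y power_series_space_add hankel_sum_add[OF \<beta>(1) \<theta> l1[OF x] l1[OF y]])
  next
    fix c :: 'a and x assume x: "x \<in> ?A"
    have "(\<lambda>n. c * x n) \<in> ?A"
      using x summable_mult[of _ "norm c"]
      by (simp add: power_series_space_def norm_mult mult.assoc)
    then show "?T (\<lambda>n. c * x n) = (\<lambda>n. c * ?T x n)"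
      by (simp add: T x hankel_sum_mult[OF \<beta>(1) \<theta> l1[OF x]])
  qed
  have cont: "continuous_map (power_series_topology \<alpha>) (power_series_topology \<beta>) ?T"
  proof (rule continuous_map_power_series_topology[OF \<alpha> \<beta>(1) T_space])
    fix k :: nat assume k: "k \<ge> 1"
    \<comment> \<open>Applies \<open>bound\<close> to \<open>y - x\<close>; the difference of the
      images is the image of the difference.\<close>
    have "ps_seminorm \<beta> k (\<lambda>n. ?T y n - ?T x n)
        \<le> ps_seminorm \<beta> k \<theta> * ps_seminorm \<alpha> 1 (\<lambda>n. y n - x n)"
      if x: "x \<in> ?A" and y: "y \<in> ?A" for x y
      using bound[OF power_series_space_diff[OF y x] k]
      by (simp add: T x y power_series_space_diff hankel_sum_diff[OF \<beta>(1) \<theta> l1[OF y] l1[OF x]])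
    then show "\<exists>l\<ge>1. \<exists>C. \<forall>x\<in>?A. \<forall>y\<in>?A.
        ps_seminorm \<beta> k (\<lambda>n. ?T y n - ?T x n) \<le> C * ps_seminorm \<alpha> l (\<lambda>n. y n - x n)"
      by blast
  qed
  \<comment> \<open>The unit ball of the first seminorm is the required neighbourhood: by
    \<open>bound\<close> its image is bounded, with the seminorms of \<open>\<theta>\<close> as the
    constants \<open>C k\<close>.\<close>
  have "ps_precompact \<beta> (?T ` ps_ball \<alpha> (\<lambda>_. 0) 1 1)"
  proof (rule ps_precompact_if_bounded[OF \<beta> assms(6)])
    show "?T ` ps_ball \<alpha> (\<lambda>_. 0) 1 1 \<subseteq> power_series_space \<beta>"
      using T_space by (auto simp: ps_ball_def)
    fix k :: nat and y assume k: "k \<ge> 1" and "y \<in> ?T ` ps_ball \<alpha> (\<lambda>_. 0) 1 1"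
    then obtain x where x: "y = ?T x" "x \<in> ?A" "ps_seminorm \<alpha> 1 x < 1"
      by (auto simp: ps_ball_def)
    then have "ps_seminorm \<beta> k y \<le> ps_seminorm \<beta> k \<theta> * ps_seminorm \<alpha> 1 x"
      using bound k by blast
    also have "\<dots> \<le> ps_seminorm \<beta> k \<theta> * 1"
      using x \<theta> k by (intro mult_left_mono) auto
    finally show "ps_seminorm \<beta> k y \<le> ps_seminorm \<beta> k \<theta>" by simp
  qed
  moreover have "zero_neighborhood \<alpha> (ps_ball \<alpha> (\<lambda>_. 0 :: 'a) 1 1)"
    by (rule zero_neighborhood_ps_ball) auto
  ultimately show ?thesis
    using ex cont linear by (auto simp: ps_compact_map_def)
qed

end
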